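(* Let $(\lambda,\mu)\in\mathbb{R}^2$ be an irrational vector (i.e. $(\lambda,\mu)\notin\mathbb{Q}^2$). Let $\|\cdot\|$ and $\|\cdot\|'$ be any two norms on $\mathbb{R}^2$, and let $\{q_k\}$ and $\{q'_k\}$ be the increasing sequences of denominators of the best approximation vectors of $(\lambda,\mu)$ with respect to $\|\cdot\|$ and $\|\cdot\|'$, respectively. Then $$\sum_k\frac{\log\log q_{k+1}}{q_k}<\infty\quad\Longleftrightarrow\quad \sum_k\frac{\log\log q'_{k+1}}{q'_k}<\infty .$$
   Context: For a norm $\|\cdot\|$ on $\mathbb{R}^2$ and $\mathbf{x}\in\mathbb{R}^2$, a rational vector $\frac{\mathbf{p}}{q}$ ($\mathbf{p}\in\mathbb{Z}^2$, $q\in\mathbb{Z}_{>0}$) is a best approximation vector of $\mathbf{x}$ if (i) $\|q\mathbf{x}-\mathbf{p}\|<\|q'\mathbf{x}-\mathbf{p}'\|$ for every $(\mathbf{p}',q')\in\mathbb{Z}^2\times\mathbb{Z}_{>0}$ with $q'<q$, and (ii) $\|q\mathbf{x}-\mathbf{p}\|\le\|q\mathbf{x}-\mathbf{p}'\|$ for every $\mathbf{p}'\in\mathbb{Z}^2$. The sequence of denominators is the list $q_1<q_2<\cdots$ of the $q$ that occur. The P\'erez-Marco condition for the sequence $\{q_k\}$ is the convergence of $\sum_k \frac{\log\log q_{k+1}}{q_k}$. *)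

theory Defs
  imports "HOL-Analysis.Analysis" "HOL-Library.Infinite_Set"
begin

definition is_norm :: "('a::real_vector \<Rightarrow> real) \<Rightarrow> bool" where
  "is_norm N \<longleftrightarrow>
     (\<forall>x. 0 \<le> N x) \<and>
     (\<forall>x. N x = 0 \<longleftrightarrow> x = 0) \<and>
     (\<forall>c x. N (c *\<^sub>R x) = \<bar>c\<bar> * N x) \<and>
     (\<forall>x y. N (x + y) \<le> N x + N y)"

definition of_int_vec :: "int ^ 2 \<Rightarrow> real ^ 2" where
  "of_int_vec p = (\<chi> i. real_of_int (p $ i))"

definition best_approximation :: "(real ^ 2 \<Rightarrow> real) \<Rightarrow> real ^ 2 \<Rightarrow> int ^ 2 \<Rightarrow> nat \<Rightarrow> bool" where
  "best_approximation N x p q \<longleftrightarrow>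
     0 < q \<and>
     (\<forall>(p' :: int ^ 2) (q' :: nat). 0 < q' \<longrightarrow> q' < q \<longrightarrow>
        N (real q *\<^sub>R x - of_int_vec p) < N (real q' *\<^sub>R x - of_int_vec p')) \<and>
     (\<forall>p' :: int ^ 2.
        N (real q *\<^sub>R x - of_int_vec p) \<le> N (real q *\<^sub>R x - of_int_vec p'))"

definition best_denominators :: "(real ^ 2 \<Rightarrow> real) \<Rightarrow> real ^ 2 \<Rightarrow> nat set" where
  "best_denominators N x = {q. \<exists>p. best_approximation N x p q}"

(* Indices start at 0: denominator_seq N x 0 is the first denominator. The function enumerate
   lists an infinite set in increasing order (on finite sets it is junk); for a norm N and
   irrational x the set of denominators is infinite. *)
definition denominator_seq :: "(real ^ 2 \<Rightarrow> real) \<Rightarrow> real ^ 2 \<Rightarrow> nat \<Rightarrow> nat" where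
  "denominator_seq N x = enumerate (best_denominators N x)"

(* For a strictly increasing sequence of positive integers q (Suc k) \<ge> 2, so the inner logarithm
   is positive, and only finitely many terms are negative. *)
definition perez_marco :: "(nat \<Rightarrow> nat) \<Rightarrow> bool" where
  "perez_marco q \<longleftrightarrow> summable (\<lambda>k. ln (ln (real (q (Suc k)))) / real (q k))"

end

theory Submission
  imports Defs
begin

text \<open>Let \<open>v < Q\<close> be consecutive denominators for one norm and \<open>w\<close> the first denominator after
  \<open>v\<close> for the other. Then \<open>Q\<close> is at most a constant times \<open>w\<^sup>2\<close>, so \<open>ln (ln Q)\<close> exceeds
  \<open>ln (ln w)\<close> by at most a constant. Since denominators at least double within eight steps, the
  sum of the reciprocals of all denominators \<open>\<ge> X\<close> is at most a constant times \<open>1 / X\<close>. Grouping the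
  terms of one series according to the gap of the other sequence that contains \<open>v\<close> bounds it by
  the other series.\<close>

section \<open>Reciprocal sums of doubling sequences\<close>

text \<open>A block of \<open>r\<close> consecutive terms contributes at most
  \<open>r / b a\<close>. After the block the leading value has at least doubled, so the block
  bounds are dominated by a geometric series of ratio 1/2, which accounts for the factor 2.\<close>

lemma sum_inverse_le_of_doubling:
  fixes b :: "nat \<Rightarrow> nat"
  assumes "mono b" and "0 < b 0" and doubling: "\<And>j. 2 * b j \<le> b (j + r)" and "0 < r"
  shows "(\<Sum>j<n. 1 / real (b (a + j))) \<le> 2 * real r / real (b a)"
proof (induction n arbitrary: a rule: less_induct)
  case (less n)
  have pos: "0 < b j" for j
    using monoD[OF \<open>mono b\<close>, of 0 j] \<open>0 < b 0\<close> by simp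
  have short: "(\<Sum>j<m. 1 / real (b (a + j))) \<le> r / real (b a)" if "m \<le> r" for m
  proof -
    have "(\<Sum>j<m. 1 / real (b (a + j))) \<le> of_nat (card {..<m}) * (1 / real (b a))"
      using pos[of a] monoD[OF \<open>mono b\<close>] by (intro sum_bounded_above) (simp add: frac_le)
    also have "\<dots> \<le> r / real (b a)"
      using that by (simp add: divide_right_mono)
    finally show ?thesis .
  qed
  show ?case
  proof (cases "n \<le> r")
    case True
    have "r / real (b a) \<le> 2 * real r / real (b a)"
      by (simp add: divide_right_mono)
    with short[OF True] show ?thesis by linarith
  next
    case False
    have split: "(\<Sum>j<r + m. g j) = (\<Sum>j<r. g j) + (\<Sum>j<m. g (r + j))" for g :: "nat \<Rightarrow> real" and m
      by (induction m) auto
    have "(\<Sum>j<n. 1 / real (b (a + j))) =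
        (\<Sum>j<r. 1 / real (b (a + j))) + (\<Sum>j<n - r. 1 / real (b (a + r + j)))"
      using split[of "\<lambda>j. 1 / real (b (a + j))" "n - r"] False by (simp add: add.assoc)
    also have "\<dots> \<le> r / real (b a) + 2 * real r / real (b (a + r))"
      using False \<open>0 < r\<close> less.IH[of "n - r" "a + r"] by (intro add_mono short) simp_all
    also have "2 * real r / real (b (a + r)) \<le> 2 * real r / real (2 * b a)"
      using pos[of a] doubling[of a] by (intro divide_left_mono) (auto simp flip: of_nat_mult)
    finally show ?thesis by simp
  qed
qed

text \<open>Filling \<open>J\<close> up to the interval from \<open>Min J\<close> to
  \<open>Max J\<close> only adds nonnegative terms, and the first value of that interval is still at
  least \<open>X\<close>.\<close>

lemma sum_inverse_set_le_of_doubling: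
  fixes b :: "nat \<Rightarrow> nat"
  assumes "mono b" and "0 < b 0" and "\<And>j. 2 * b j \<le> b (j + r)" and "0 < r"
    and "finite J" and "0 < X" and "\<And>j. j \<in> J \<Longrightarrow> X \<le> b j"
  shows "(\<Sum>j\<in>J. 1 / real (b j)) \<le> 2 * real r / real X"
proof (cases "J = {}")
  case False
  define a where "a = Min J"
  define n where "n = Suc (Max J) - a"
  have "a \<in> J" using False \<open>finite J\<close> by (simp add: a_def)
  have "J \<subseteq> (\<lambda>i. a + i) ` {..<n}"
  proof
    fix j assume "j \<in> J"
    then have "a \<le> j" "j \<le> Max J" using \<open>finite J\<close> by (auto simp: a_def)
    then show "j \<in> (\<lambda>i. a + i) ` {..<n}"
      by (intro image_eqI[of _ _ "j - a"]) (auto simp: n_def)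
  qed
  then have "(\<Sum>j\<in>J. 1 / real (b j)) \<le> (\<Sum>j\<in>(\<lambda>i. a + i) ` {..<n}. 1 / real (b j))"
    by (intro sum_mono2) auto
  also have "\<dots> = (\<Sum>i<n. 1 / real (b (a + i)))"
    by (subst sum.reindex) auto
  also have "\<dots> \<le> 2 * real r / real (b a)"
    by (rule sum_inverse_le_of_doubling) (use assms in auto)
  also have "\<dots> \<le> 2 * real r / real X"
    using \<open>0 < X\<close> assms(7)[OF \<open>a \<in> J\<close>] by (intro divide_left_mono) auto
  finally show ?thesis .
qed simp

section \<open>Comparison of the series of two integer sequences\<close>

lemma strict_mono_nat_bracket:
  fixes a :: "nat \<Rightarrow> nat"
  assumes "strict_mono a" and "a 0 \<le> n"
  obtains k where "a k \<le> n" and "n < a (Suc k)"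
proof -
  define i where "i = (LEAST i. n < a i)"
  have "n < a (Suc n)"
    using strict_mono_imp_increasing[OF \<open>strict_mono a\<close>, of "Suc n"] by simp
  then have i: "n < a i" unfolding i_def by (rule LeastI)
  then have "i \<noteq> 0" using assms(2) by (auto intro: ccontr)
  then obtain k where k: "i = Suc k" by (cases i) auto
  have "\<not> n < a k"
    using not_less_Least[of k "\<lambda>i. n < a i"] k unfolding i_def by simp
  with i k that show ?thesis by (auto simp: not_less)
qed

text \<open>One logarithm turns the hypothesis into
  \<open>ln Q \<le> ln K + 2 * ln w \<le> D * ln w\<close>, using \<open>ln w \<ge> ln 2\<close>.
  The second logarithm makes the factor \<open>D\<close> an additive constant.\<close>

lemma ln_ln_le_of_le_square:
  fixes K :: real
  assumes "1 \<le> K"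
  obtains c where "0 \<le> c"
    and "\<And>Q w :: nat. 2 \<le> Q \<Longrightarrow> 2 \<le> w \<Longrightarrow> real Q \<le> K * (real w)\<^sup>2 \<Longrightarrow>
      \<bar>ln (ln (real Q))\<bar> \<le> \<bar>ln (ln (real w))\<bar> + c"
proof -
  define D where "D = ln K / ln 2 + 2"
  have D: "0 < D" unfolding D_def using assms
    by (intro add_nonneg_pos divide_nonneg_pos) auto
  have bound: "\<bar>ln (ln (real Q))\<bar> \<le> \<bar>ln (ln (real w))\<bar> + (\<bar>ln D\<bar> + \<bar>ln (ln 2)\<bar>)"
    if Q: "2 \<le> Q" and w: "2 \<le> w" and le: "real Q \<le> K * (real w)\<^sup>2" for Q w :: nat
  proof -
    have "ln 2 \<le> ln (real w)" using w by simp
    have lnQ: "ln 2 \<le> ln (real Q)" using Q by simp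
    have "ln (real Q) \<le> ln (K * (real w)\<^sup>2)"
      using Q le by (intro ln_mono) auto
    also have "\<dots> = ln K + 2 * ln (real w)"
      using assms w by (simp add: ln_mult ln_realpow)
    also have "ln K \<le> (ln K / ln 2) * ln (real w)"
      using mult_left_mono[OF \<open>ln 2 \<le> ln (real w)\<close>, of "ln K / ln 2"] assms by simp
    finally have "ln (real Q) \<le> D * ln (real w)" by (simp add: D_def algebra_simps)
    moreover have "0 < ln (real Q)" "0 < ln (real w)" using Q w by simp_all
    ultimately have "ln (ln (real Q)) \<le> ln D + ln (ln (real w))"
      using D by (metis ln_mono ln_mult less_numeral_extra(3) less_irrefl)
    \<comment> \<open>The iterated logarithm is negative at 2, so its absolute value needs a lower
      bound as well.\<close>
    moreover have "ln (ln 2) \<le> ln (ln (real Q))"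
      using lnQ by (rule ln_mono) auto
    ultimately show ?thesis by linarith
  qed
  show ?thesis by (rule that[OF _ bound]) auto
qed

text \<open>For \<open>k \<ge> 2\<close> the argument \<open>q (Suc k)\<close> is at least 3, hence
  exceeds e, and the term is nonnegative. The two series differ in finitely many terms only, and the
  nonnegative one can be controlled through its partial sums.\<close>

lemma perez_marco_abs:
  assumes "strict_mono q"
  shows "perez_marco q \<longleftrightarrow> summable (\<lambda>k. \<bar>ln (ln (real (q (Suc k))))\<bar> / real (q k))"
  unfolding perez_marco_def
proof (rule summable_cong)
  show "\<forall>\<^sub>F k in sequentially.
      ln (ln (real (q (Suc k)))) / real (q k) = \<bar>ln (ln (real (q (Suc k))))\<bar> / real (q k)"
    using eventually_ge_at_top[of 2]
  proof eventually_elim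
    case (elim k)
    then have "3 \<le> q (Suc k)"
      using strict_mono_imp_increasing[OF assms, of "Suc k"] by simp
    then have "exp 1 \<le> real (q (Suc k))" using exp_le by linarith
    then have "ln (exp 1) \<le> ln (real (q (Suc k)))" by (intro ln_mono) auto
    then show ?case by simp
  qed
qed

text \<open>The analytic core, free of norms: \<open>b j\<close> lies in some gap of
  \<open>a\<close>, and by \<open>K\<close> the iterated logarithm of \<open>b (Suc j)\<close>
  exceeds that of the right end of this gap by at most a constant.\<close>

lemma perez_marco_transfer:
  fixes a b :: "nat \<Rightarrow> nat"
  assumes a: "strict_mono a" "0 < a 0" and b: "strict_mono b" "a 0 \<le> b 0"
    and doubling: "\<And>j. 2 * b j \<le> b (j + r)" "0 < r"
    and K: "1 \<le> K"
      "\<And>j k. a k \<le> b j \<Longrightarrow> b j < a (Suc k) \<Longrightarrow> real (b (Suc j)) \<le> K * (real (a (Suc k)))\<^sup>2"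
    and "perez_marco a"
  shows "perez_marco b"
proof -
  define f where "f = (\<lambda>k. \<bar>ln (ln (real (a (Suc k))))\<bar>)"
  have sum_f: "summable (\<lambda>k. f k / real (a k))"
    using \<open>perez_marco a\<close> perez_marco_abs[OF a(1)] by (simp add: f_def)
  have bmono: "mono b" and bpos: "0 < b 0"
    using a(2) b by (auto simp: strict_mono_mono)
  obtain c where c: "0 \<le> c" "\<And>Q w :: nat. 2 \<le> Q \<Longrightarrow> 2 \<le> w \<Longrightarrow> real Q \<le> K * (real w)\<^sup>2 \<Longrightarrow>
      \<bar>ln (ln (real Q))\<bar> \<le> \<bar>ln (ln (real w))\<bar> + c"
    using ln_ln_le_of_le_square[OF K(1)] by blast
  have "\<exists>k. a k \<le> b j \<and> b j < a (Suc k)" for j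
  proof -
    have "a 0 \<le> b j" using monoD[OF bmono, of 0 j] b(2) by simp
    then show ?thesis using strict_mono_nat_bracket[OF a(1)] by blast
  qed
  then obtain \<kappa> where \<kappa>: "\<And>j. a (\<kappa> j) \<le> b j" "\<And>j. b j < a (Suc (\<kappa> j))" by metis
  have ge2: "2 \<le> q (Suc k)" if "strict_mono q" "0 < q 0" for q :: "nat \<Rightarrow> nat" and k
    using strict_monoD[OF that(1), of 0 "Suc k"] that(2) by simp
  have term_le: "\<bar>ln (ln (real (b (Suc j))))\<bar> / real (b j) \<le> f (\<kappa> j) / real (b j) + c / real (b j)"
    for j
    using c(2)[OF ge2[OF b(1) bpos] ge2[OF a] K(2)[OF \<kappa>]]
    by (simp add: f_def divide_right_mono flip: add_divide_distrib)
  have partial: "(\<Sum>j<n. \<bar>ln (ln (real (b (Suc j))))\<bar> / real (b j)) \<le>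
      2 * real r * (\<Sum>k. f k / real (a k)) + c * (2 * real r / real (b 0))" for n
  proof -
    \<comment> \<open>All \<open>b j\<close> in the fibre are at least \<open>a k\<close>, so their
      reciprocals sum to at most \<open>2 * r / a k\<close>, while \<open>f\<close> is constant on
      the fibre.\<close>
    have fibre: "(\<Sum>j | j \<in> {..<n} \<and> \<kappa> j = k. f (\<kappa> j) / real (b j)) \<le> 2 * real r * (f k / real (a k))"
      for k
    proof -
      have "0 < a k" using a strict_mono_mono[OF a(1)] by (metis gr0I le0 le_zero_eq monoD)
      then have "(\<Sum>j | j \<in> {..<n} \<and> \<kappa> j = k. 1 / real (b j)) \<le> 2 * real r / real (a k)"
        by (intro sum_inverse_set_le_of_doubling[OF bmono bpos doubling]) (use \<kappa>(1) in auto)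
      then have "f k * (\<Sum>j | j \<in> {..<n} \<and> \<kappa> j = k. 1 / real (b j)) \<le> f k * (2 * real r / real (a k))"
        by (rule mult_left_mono) (simp add: f_def)
      then show ?thesis by (simp add: sum_distrib_left mult_ac)
    qed
    have "(\<Sum>j<n. \<bar>ln (ln (real (b (Suc j))))\<bar> / real (b j)) \<le>
        (\<Sum>j<n. f (\<kappa> j) / real (b j) + c / real (b j))"
      by (intro sum_mono term_le)
    also have "\<dots> = (\<Sum>j<n. f (\<kappa> j) / real (b j)) + (\<Sum>j<n. c / real (b j))"
      by (rule sum.distrib)
    also have "(\<Sum>j<n. f (\<kappa> j) / real (b j)) =
        (\<Sum>k\<in>\<kappa> ` {..<n}. \<Sum>j | j \<in> {..<n} \<and> \<kappa> j = k. f (\<kappa> j) / real (b j))"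
      by (rule sum.group[symmetric]) auto
    also have "\<dots> \<le> (\<Sum>k\<in>\<kappa> ` {..<n}. 2 * real r * (f k / real (a k)))"
      by (intro sum_mono fibre)
    also have "\<dots> = 2 * real r * (\<Sum>k\<in>\<kappa> ` {..<n}. f k / real (a k))"
      by (simp add: sum_distrib_left)
    also have "\<dots> \<le> 2 * real r * (\<Sum>k. f k / real (a k))"
      by (intro mult_left_mono sum_le_suminf sum_f) (auto simp: f_def)
    also have "(\<Sum>j<n. c / real (b j)) = c * (\<Sum>j<n. 1 / real (b (0 + j)))"
      by (simp add: sum_distrib_left)
    also have "\<dots> \<le> c * (2 * real r / real (b 0))"
      by (intro mult_left_mono sum_inverse_le_of_doubling[OF bmono bpos doubling] c(1))
    finally show ?thesis by simp
  qed
  have "summable (\<lambda>j. \<bar>ln (ln (real (b (Suc j))))\<bar> / real (b j))"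
    \<comment> \<open>The shift turns sums over \<open>j < Suc n\<close> into sums over
      \<open>j \<le> n\<close>, the form that \<open>bounded_imp_summable\<close> expects.\<close>
    using partial[of "Suc _"] by (intro bounded_imp_summable) (simp_all only: lessThan_Suc_atMost, simp)
  then show ?thesis using perez_marco_abs[OF b(1)] by simp
qed

section \<open>Norms on the plane\<close>

context
  fixes N :: "real ^ 2 \<Rightarrow> real"
  assumes N: "is_norm N"
begin

lemma is_norm_nonneg: "0 \<le> N v"
  and is_norm_zero_iff: "N v = 0 \<longleftrightarrow> v = 0"
  and is_norm_scale: "N (c *\<^sub>R v) = \<bar>c\<bar> * N v"
  and is_norm_triangle: "N (v + w) \<le> N v + N w"
  using N by (simp_all add: is_norm_def)

lemma is_norm_triangle_diff: "N (v - w) \<le> N v + N w"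
  using is_norm_triangle[of v "(-1) *\<^sub>R w"] is_norm_scale[of "-1" w] by simp

text \<open>Expansion in the standard basis gives the upper bound, which makes \<open>N\<close>
  Lipschitz. On the compact unit sphere \<open>N\<close> therefore attains a positive minimum, and
  scaling gives the other bound.\<close>

lemma is_norm_equivalent: "\<exists>C>0. \<forall>v. N v \<le> C * norm v \<and> norm v \<le> C * N v"
proof -
  define A where "A = N (axis 1 1) + N (axis 2 1)"
  have A: "0 \<le> A" by (simp add: A_def is_norm_nonneg)
  have upper: "N v \<le> A * norm v" for v
  proof -
    have "v = v $ 1 *\<^sub>R axis 1 1 + v $ 2 *\<^sub>R axis 2 1"
      by (simp add: vec_eq_iff forall_2 axis_def)
    then have "N v \<le> \<bar>v $ 1\<bar> * N (axis 1 1) + \<bar>v $ 2\<bar> * N (axis 2 1)"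
      by (metis is_norm_scale is_norm_triangle)
    also have "\<dots> \<le> norm v * N (axis 1 1) + norm v * N (axis 2 1)"
      by (intro add_mono mult_right_mono component_le_norm_cart is_norm_nonneg)
    finally show ?thesis by (simp add: A_def algebra_simps)
  qed
  have "\<bar>N v - N w\<bar> \<le> A * norm (v - w)" for v w
    using is_norm_triangle[of "v - w" w] is_norm_triangle_diff[of v "v - w"] upper[of "v - w"] by simp
  then have "A-lipschitz_on (sphere 0 1) N"
    using A by (intro lipschitz_onI) (auto simp: dist_norm)
  then have cont: "continuous_on (sphere 0 1) N"
    by (rule lipschitz_on_continuous_on)
  have "axis 1 1 \<in> (sphere 0 1 :: (real ^ 2) set)" by simp
  then obtain u where u: "u \<in> sphere 0 1" "\<And>v. v \<in> sphere 0 1 \<Longrightarrow> N u \<le> N v"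
    using continuous_attains_inf[OF compact_sphere _ cont] by blast
  then have Nu: "0 < N u"
    using is_norm_nonneg[of u] is_norm_zero_iff[of u] by force
  have lower: "norm v \<le> inverse (N u) * N v" for v
  proof (cases "v = 0")
    case False
    then have "N u \<le> N (inverse (norm v) *\<^sub>R v)" by (intro u(2)) simp
    also have "\<dots> = inverse (norm v) * N v" by (simp add: is_norm_scale)
    finally show ?thesis using False Nu by (simp add: field_simps)
  qed (simp add: is_norm_nonneg)
  define C where "C = max A (inverse (N u))"
  have "0 < C" using Nu by (simp add: C_def less_max_iff_disj)
  moreover have "N v \<le> C * norm v" for v
    using upper[of v] mult_right_mono[of A C "norm v"] by (simp add: C_def)
  moreover have "norm v \<le> C * N v" for v
    using lower[of v] mult_right_mono[of "inverse (N u)" C "N v"] is_norm_nonneg[of v]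
    by (simp add: C_def)
  ultimately show ?thesis by blast
qed

end

section \<open>Integer vectors and simultaneous Dirichlet approximation\<close>

lemma of_int_vec_nth [simp]: "of_int_vec p $ i = real_of_int (p $ i)"
  by (simp add: of_int_vec_def)

lemma norm_of_int_vec_ge_1:
  assumes "of_int_vec p \<noteq> 0"
  shows "1 \<le> norm (of_int_vec p)"
proof -
  obtain i where "p $ i \<noteq> 0" using assms by (auto simp: vec_eq_iff)
  then have "1 \<le> \<bar>of_int_vec p $ i\<bar>" by simp
  also have "\<dots> \<le> norm (of_int_vec p)" by (rule component_le_norm_cart)
  finally show ?thesis .
qed

lemma finite_of_int_vec_ball: "finite {p. norm (v - of_int_vec p) \<le> r}"
proof -
  define I where "I = (\<lambda>i. {\<lfloor>v $ i - r\<rfloor>..\<lceil>v $ i + r\<rceil>})"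
  have "p \<in> (\<lambda>(a, b). vector [a, b]) ` (I 1 \<times> I 2)" if "norm (v - of_int_vec p) \<le> r" for p
  proof -
    have "\<bar>(v - of_int_vec p) $ i\<bar> \<le> r" for i
      using component_le_norm_cart[of "v - of_int_vec p" i] that by linarith
    then have "\<bar>v $ i - real_of_int (p $ i)\<bar> \<le> r" for i by simp
    then have "p $ i \<in> I i" for i
      unfolding I_def atLeastAtMost_iff by (smt (verit, best) floor_le_iff le_ceiling_iff)
    moreover have "p = vector [p $ 1, p $ 2]" by (simp add: vec_eq_iff forall_2)
    ultimately show ?thesis by (intro image_eqI[of _ _ "(p $ 1, p $ 2)"]) auto
  qed
  then have "{p. norm (v - of_int_vec p) \<le> r} \<subseteq> (\<lambda>(a, b). vector [a, b]) ` (I 1 \<times> I 2)" by blast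
  then show ?thesis by (rule finite_subset) (simp add: I_def)
qed

text \<open>Dirichlet's theorem makes both coordinate errors less than \<open>1 / T\<close>; the
  Euclidean norm is at most their sum.\<close>

lemma dirichlet_plane:
  fixes x :: "real ^ 2" and T :: nat
  assumes "0 < T"
  obtains q p where "0 < q" and "q \<le> T\<^sup>2" and "norm (real q *\<^sub>R x - of_int_vec p) \<le> 2 / T"
proof -
  define \<theta> where "\<theta> = (\<lambda>i :: nat. if i = 0 then x $ 1 else x $ 2)"
  have "\<exists>q p. 0 < q \<and> q \<le> int (T\<^sup>2) \<and> (\<forall>i<2. \<bar>of_int q * \<theta> i - of_int (p i)\<bar> < 1 / T)"
    by (rule Dirichlet_approx_simult[OF assms, of 2 \<theta>]) blast
  then obtain q p where q: "0 < q" "q \<le> int (T\<^sup>2)"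
    and p: "\<And>i. i < 2 \<Longrightarrow> \<bar>of_int q * \<theta> i - of_int (p i)\<bar> < 1 / T"
    by blast
  define v where "v = real (nat q) *\<^sub>R x - of_int_vec (vector [p 0, p 1])"
  have "norm v \<le> \<bar>v $ 1\<bar> + \<bar>v $ 2\<bar>"
    using norm_le_l1_cart[of v] by (simp add: sum_2)
  also have "\<dots> \<le> 2 / T"
    using p[of 0] p[of 1] q(1) by (simp add: v_def \<theta>_def)
  finally show ?thesis
    using q by (intro that[of "nat q" "vector [p 0, p 1]"]) (auto simp: v_def nat_le_iff)
qed

section \<open>Best approximation denominators for one norm\<close>

locale plane_approximation =
  fixes N :: "real ^ 2 \<Rightarrow> real" and x :: "real ^ 2"
  assumes N: "is_norm N"
    and irrational: "0 < q \<Longrightarrow> real q *\<^sub>R x \<noteq> of_int_vec p"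
begin

text \<open>The distance from \<open>q x\<close> to the integer lattice. It lets best denominators
  be described without reference to numerators.\<close>

definition lattice_dist :: "nat \<Rightarrow> real" where
  "lattice_dist q = (INF p. N (real q *\<^sub>R x - of_int_vec p))"

lemma lattice_dist_le: "lattice_dist q \<le> N (real q *\<^sub>R x - of_int_vec p)"
  unfolding lattice_dist_def
  by (rule cINF_lower) (auto intro!: bdd_belowI[of _ 0] is_norm_nonneg[OF N])

text \<open>By equivalence with the Euclidean norm only finitely many \<open>p\<close> do at least
  as well as \<open>p = 0\<close>, and a minimum over these is a global one.\<close>

lemma lattice_dist_attained: "\<exists>p. N (real q *\<^sub>R x - of_int_vec p) = lattice_dist q"
proof -
  let ?f = "\<lambda>p. N (real q *\<^sub>R x - of_int_vec p)"
  obtain C where C: "0 < C" "\<forall>v. norm v \<le> C * N v"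
    using is_norm_equivalent[OF N] by blast
  define P where "P = {p. ?f p \<le> ?f 0}"
  have "P \<subseteq> {p. norm (real q *\<^sub>R x - of_int_vec p) \<le> C * ?f 0}"
    using C by (auto simp: P_def intro: order_trans[OF C(2)[rule_format]] mult_left_mono)
  then have "finite P" by (rule finite_subset) (rule finite_of_int_vec_ball)
  moreover have "0 \<in> P" by (simp add: P_def)
  ultimately obtain p where p: "p \<in> P" "\<And>p'. p' \<in> P \<Longrightarrow> ?f p \<le> ?f p'"
    using arg_min_if_finite[of P ?f] by (metis empty_iff not_le)
  have "?f p \<le> ?f p'" for p'
    using p(1) p(2)[of p'] by (cases "p' \<in> P") (auto simp: P_def)
  then have "?f p \<le> lattice_dist q"
    unfolding lattice_dist_def by (intro cINF_greatest) auto
  with lattice_dist_le[of q p] show ?thesis by (intro exI[of _ p]) simp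
qed

lemma lattice_dist_pos:
  assumes "0 < q"
  shows "0 < lattice_dist q"
proof -
  obtain p where p: "N (real q *\<^sub>R x - of_int_vec p) = lattice_dist q"
    using lattice_dist_attained by blast
  have "real q *\<^sub>R x - of_int_vec p \<noteq> 0" using irrational[OF assms] by simp
  then show ?thesis using p is_norm_nonneg[OF N] is_norm_zero_iff[OF N] by (metis less_eq_real_def)
qed

text \<open>Since the minimum over numerators is attained, numerators can be eliminated: best
  denominators are the strict record minima of \<open>lattice_dist\<close>.\<close>

lemma best_denominators_iff:
  "q \<in> best_denominators N x \<longleftrightarrow>
     0 < q \<and> (\<forall>r. 0 < r \<longrightarrow> r < q \<longrightarrow> lattice_dist q < lattice_dist r)" (is "?L \<longleftrightarrow> ?R")
proof
  assume ?L
  then obtain p where p: "best_approximation N x p q" by (auto simp: best_denominators_def)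
  have "lattice_dist q < lattice_dist r" if "0 < r" "r < q" for r
  proof -
    obtain p' where "N (real r *\<^sub>R x - of_int_vec p') = lattice_dist r"
      using lattice_dist_attained by blast
    then have "N (real q *\<^sub>R x - of_int_vec p) < lattice_dist r"
      using p that unfolding best_approximation_def by metis
    with lattice_dist_le[of q p] show ?thesis by linarith
  qed
  then show ?R using p by (simp add: best_approximation_def)
next
  assume R: ?R
  obtain p where "N (real q *\<^sub>R x - of_int_vec p) = lattice_dist q"
    using lattice_dist_attained by blast
  then have "best_approximation N x p q"
    unfolding best_approximation_def using R lattice_dist_le by (metis less_le_trans)
  then show ?L by (auto simp: best_denominators_def)
qed

lemma one_in_best_denominators: "1 \<in> best_denominators N x"
  by (simp add: best_denominators_iff)

lemma lattice_dist_dirichlet: "\<exists>C>0. \<forall>T>0. \<exists>q. 0 < q \<and> q \<le> T\<^sup>2 \<and> lattice_dist q \<le> C / real T"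
proof -
  obtain A where A: "0 < A" "\<forall>v. N v \<le> A * norm v"
    using is_norm_equivalent[OF N] by blast
  have "\<exists>q. 0 < q \<and> q \<le> T\<^sup>2 \<and> lattice_dist q \<le> 2 * A / real T" if "0 < T" for T
  proof -
    obtain q p where q: "0 < q" "q \<le> T\<^sup>2" and p: "norm (real q *\<^sub>R x - of_int_vec p) \<le> 2 / T"
      using dirichlet_plane[OF \<open>0 < T\<close>] by blast
    have "lattice_dist q \<le> A * norm (real q *\<^sub>R x - of_int_vec p)"
      using lattice_dist_le A(2)[rule_format] by (rule order_trans)
    also have "\<dots> \<le> A * (2 / T)"
      using A(1) p by (intro mult_left_mono) auto
    finally show ?thesis using q by (auto simp: mult_ac)
  qed
  then show ?thesis using A(1) by (intro exI[of _ "2 * A"]) auto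
qed

lemma infinite_best_denominators: "infinite (best_denominators N x)"
  unfolding infinite_nat_iff_unbounded
proof
  fix n
  \<comment> \<open>The bound \<open>Suc n\<close> keeps the range nonempty for
    \<open>n = 0\<close>.\<close>
  define \<delta> where "\<delta> = Min (lattice_dist ` {1..Suc n})"
  have \<delta>: "\<delta> \<le> lattice_dist r" if "0 < r" "r \<le> Suc n" for r
    unfolding \<delta>_def using that by (intro Min_le) auto
  have "0 < \<delta>" unfolding \<delta>_def by (subst Min_gr_iff) (auto intro: lattice_dist_pos)
  obtain C where C: "0 < C"
    and dirichlet: "\<And>T. 0 < T \<Longrightarrow> \<exists>q. 0 < q \<and> q \<le> T\<^sup>2 \<and> lattice_dist q \<le> C / real T"
    using lattice_dist_dirichlet by blast
  obtain T :: nat where T: "C / \<delta> < T" using reals_Archimedean2 by blast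
  moreover have "0 < C / \<delta>" using C \<open>0 < \<delta>\<close> by simp
  ultimately have "0 < T" by (metis less_trans of_nat_0_less_iff)
  with T \<open>0 < \<delta>\<close> have "C / T < \<delta>" by (simp add: field_simps)
  \<comment> \<open>Dirichlet's theorem provides values below \<open>\<delta>\<close>. The first
    place where one occurs is a strict record and lies beyond \<open>n\<close> by the choice of
    \<open>\<delta>\<close>.\<close>
  define q where "q = (LEAST q. 0 < q \<and> lattice_dist q < \<delta>)"
  have "\<exists>q. 0 < q \<and> lattice_dist q < \<delta>"
    using dirichlet[OF \<open>0 < T\<close>] \<open>C / T < \<delta>\<close> by (meson le_less_trans)
  then have q: "0 < q" "lattice_dist q < \<delta>"
    unfolding q_def by (metis (mono_tags, lifting) LeastI)+
  have "lattice_dist q < lattice_dist r" if "0 < r" "r < q" for r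
    using not_less_Least[of r "\<lambda>q. 0 < q \<and> lattice_dist q < \<delta>"] that q(2) unfolding q_def by auto
  moreover have "n < q" using \<delta>[of q] q by fastforce
  ultimately show "\<exists>q>n. q \<in> best_denominators N x"
    using q(1) by (auto simp: best_denominators_iff)
qed

lemma denominator_seq_in: "denominator_seq N x k \<in> best_denominators N x"
  by (simp add: denominator_seq_def enumerate_in_set infinite_best_denominators)

lemma strict_mono_denominator_seq: "strict_mono (denominator_seq N x)"
  by (simp add: denominator_seq_def strict_mono_enumerate infinite_best_denominators)

lemma denominator_seq_0: "denominator_seq N x 0 = 1"
proof -
  have "denominator_seq N x 0 \<le> 1"
    by (simp add: denominator_seq_def enumerate_0 Least_le one_in_best_denominators[simplified])
  moreover have "0 < denominator_seq N x 0"
    using denominator_seq_in best_denominators_iff by blast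
  ultimately show ?thesis by simp
qed

text \<open>If some \<open>r\<close> in the gap did better, the first index that beats
  \<open>denominator_seq N x j\<close> would be a record strictly between two consecutive
  denominators.\<close>

lemma lattice_dist_gap:
  assumes "denominator_seq N x j \<le> r" and "r < denominator_seq N x (Suc j)"
  shows "lattice_dist (denominator_seq N x j) \<le> lattice_dist r"
proof (rule ccontr)
  let ?a = "denominator_seq N x j"
  assume contra: "\<not> ?thesis"
  define q where "q = (LEAST q. 0 < q \<and> lattice_dist q < lattice_dist ?a)"
  have a: "0 < ?a" "\<And>s. 0 < s \<Longrightarrow> s < ?a \<Longrightarrow> lattice_dist ?a < lattice_dist s"
    using denominator_seq_in best_denominators_iff by blast+
  have r: "0 < r \<and> lattice_dist r < lattice_dist ?a"
    using contra assms(1) a(1) by simp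
  then have q: "0 < q \<and> lattice_dist q < lattice_dist ?a"
    unfolding q_def by (rule LeastI)
  have "q \<le> r" unfolding q_def using r by (rule Least_le)
  have "lattice_dist q < lattice_dist s" if "0 < s" "s < q" for s
    using not_less_Least[of s "\<lambda>q. 0 < q \<and> lattice_dist q < lattice_dist ?a"] that q
    unfolding q_def by auto
  then have "q \<in> best_denominators N x" using q by (simp add: best_denominators_iff)
  then obtain i where i: "q = denominator_seq N x i"
    using enumerate_Ex[OF infinite_best_denominators] by (metis denominator_seq_def)
  have "?a < q" using q a by (metis less_asym linorder_neqE_nat)
  then have "j < i" using i strict_mono_denominator_seq by (simp add: strict_mono_less)
  then have "denominator_seq N x (Suc j) \<le> q"
    using i strict_mono_denominator_seq by (simp add: strict_mono_less_eq)
  with \<open>q \<le> r\<close> assms(2) show False by simp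
qed

text \<open>Two of any nine consecutive best approximations agree modulo 2, and half their difference
  approximates strictly better than the earlier one.\<close>

lemma denominator_seq_doubling: "2 * denominator_seq N x j \<le> denominator_seq N x (j + 8)"
proof -
  let ?q = "denominator_seq N x"
  define p where "p = (\<lambda>i. SOME p. N (real (?q i) *\<^sub>R x - of_int_vec p) = lattice_dist (?q i))"
  have p: "N (real (?q i) *\<^sub>R x - of_int_vec (p i)) = lattice_dist (?q i)" for i
    unfolding p_def by (rule someI_ex) (rule lattice_dist_attained)
  \<comment> \<open>Three parities give eight classes, while \<open>{j..j + 8}\<close> has nine
    indices.\<close>
  define parity where "parity = (\<lambda>i. (even (?q i), even (p i $ 1), even (p i $ 2)))"
  have "\<not> inj_on parity {j..j + 8}"
  proof
    assume "inj_on parity {j..j + 8}"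
    then have "card {j..j + 8} \<le> card (UNIV :: (bool \<times> bool \<times> bool) set)"
      by (intro card_inj_on_le) auto
    then show False by (simp add: card_UNIV_bool)
  qed
  then obtain a b where "a \<in> {j..j + 8}" "b \<in> {j..j + 8}" "parity a = parity b" "a < b"
    unfolding inj_on_def by (metis linorder_neqE_nat)
  then have ab: "j \<le> a" "b \<le> j + 8" "a < b" "parity a = parity b" by auto
  have "?q a < ?q b" using strict_mono_denominator_seq ab(3) by (simp add: strict_mono_less)
  have "even (?q b - ?q a)" using ab(4) by (auto simp: parity_def)
  then obtain r where r: "?q b - ?q a = 2 * r" by blast
  have "\<exists>s. p b $ i - p a $ i = 2 * s" for i
    using ab(4) exhaust_2[of i] unfolding parity_def dvd_def[symmetric] by auto
  then obtain s where s: "\<And>i. p b $ i - p a $ i = 2 * s i" by metis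
  have rq: "0 < r" "real (?q b) - real (?q a) = 2 * real r"
    using r \<open>?q a < ?q b\<close> by (auto simp flip: of_nat_diff)
  \<comment> \<open>Half the difference of the two approximations has denominator \<open>r\<close>
    and integer numerator; its error is at most the mean of the errors at \<open>b\<close> and
    \<open>a\<close>, hence below the error at \<open>a\<close>.\<close>
  have "2 *\<^sub>R (real r *\<^sub>R x - of_int_vec (\<chi> i. s i)) =
      (real (?q b) *\<^sub>R x - of_int_vec (p b)) - (real (?q a) *\<^sub>R x - of_int_vec (p a))" (is "_ = ?v - ?u")
  proof -
    have "2 * real_of_int (s i) = p b $ i - p a $ i" for i using s[of i] by simp
    then show ?thesis using rq(2) by (simp add: vec_eq_iff algebra_simps flip: distrib_right)
  qed
  then have "2 * N (real r *\<^sub>R x - of_int_vec (\<chi> i. s i)) \<le> N ?v + N ?u"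
    using is_norm_triangle_diff[OF N, of ?v ?u] is_norm_scale[OF N, of 2] by (metis abs_numeral)
  also have "\<dots> = lattice_dist (?q b) + lattice_dist (?q a)" using p by simp
  also have "lattice_dist (?q b) < lattice_dist (?q a)"
    using denominator_seq_in best_denominators_iff \<open>?q a < ?q b\<close> by metis
  finally have "lattice_dist r < lattice_dist (?q a)"
    using lattice_dist_le[of r "\<chi> i. s i"] by linarith
  \<comment> \<open>Nothing below the record \<open>?q a\<close> does better than it. Hence
    \<open>?q b = ?q a + 2 * r\<close> is at least three times \<open>?q a\<close>.\<close>
  then have "?q a \<le> r"
    using rq(1) denominator_seq_in[of a] best_denominators_iff by (metis less_asym not_le)
  have "?q j \<le> ?q a" "?q b \<le> ?q (j + 8)"
    using ab strict_mono_denominator_seq by (simp_all add: strict_mono_less_eq)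
  with r \<open>?q a \<le> r\<close> \<open>?q a < ?q b\<close> show ?thesis by linarith
qed

end

section \<open>Comparison of the denominators for two norms\<close>

locale two_plane_approximations =
  first: plane_approximation N x + second: plane_approximation N' x
  for N N' :: "real ^ 2 \<Rightarrow> real" and x
begin

text \<open>If \<open>v < w < Q\<close>, where \<open>v\<close> and \<open>Q\<close> are consecutive denominators for \<open>N'\<close> and \<open>w\<close> is one for
  \<open>N\<close>, then the fractions with denominators \<open>v\<close> and \<open>w\<close> differ, so
  \<open>w *\<^sub>R (v x - p\<^sub>v) - v *\<^sub>R (w x - p\<^sub>w)\<close> is a nonzero integer vector. This bounds \<open>w\<close> times the
  \<open>N'\<close>-distance at \<open>v\<close> from below, while Dirichlet bounds \<open>Q\<close> times its square from above.\<close>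

lemma denominator_seq_gap:
  "\<exists>K\<ge>1. \<forall>j k. denominator_seq N x k \<le> denominator_seq N' x j \<longrightarrow>
     denominator_seq N' x j < denominator_seq N x (Suc k) \<longrightarrow>
     real (denominator_seq N' x (Suc j)) \<le> K * (real (denominator_seq N x (Suc k)))\<^sup>2"
proof -
  obtain A where A: "0 < A" "\<forall>v. N' v \<le> A * norm v \<and> norm v \<le> A * N' v"
    using is_norm_equivalent[OF second.N] by blast
  obtain B where B: "0 < B" "\<forall>v. N v \<le> B * norm v \<and> norm v \<le> B * N v"
    using is_norm_equivalent[OF first.N] by blast
  obtain C where C: "0 < C"
    "\<forall>T>0. \<exists>q. 0 < q \<and> q \<le> T\<^sup>2 \<and> second.lattice_dist q \<le> C / real T"
    using second.lattice_dist_dirichlet by blast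
  \<comment> \<open>The factor bounding \<open>norm e + norm f\<close> by \<open>\<delta>\<close>:
    \<open>A\<close> serves for \<open>e\<close>, and \<open>B * (B * A)\<close> for
    \<open>f\<close>, through \<open>N f < N e\<close>.\<close>
  define F where "F = A + B * (B * A)"
  have F: "0 < F" using A B by (simp add: F_def add_pos_pos)
  \<comment> \<open>The second entry combines \<open>Q \<le> 4 * T^2\<close> with
    \<open>T \<le> w * F * C\<close>; the entry 1 covers \<open>Q \<le> w\<close>.\<close>
  define K where "K = max 1 (4 * C\<^sup>2 * F\<^sup>2)"
  have "real (denominator_seq N' x (Suc j)) \<le> K * (real (denominator_seq N x (Suc k)))\<^sup>2"
    if "denominator_seq N' x j < denominator_seq N x (Suc k)" for j k
  proof -
    define v w Q where "v = denominator_seq N' x j" and "w = denominator_seq N x (Suc k)"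
      and "Q = denominator_seq N' x (Suc j)"
    define \<delta> where "\<delta> = second.lattice_dist v"
    have v: "0 < v" and w: "0 < w" "\<And>r. 0 < r \<Longrightarrow> r < w \<Longrightarrow> first.lattice_dist w < first.lattice_dist r"
      using second.denominator_seq_in[of j] first.denominator_seq_in[of "Suc k"]
      unfolding v_def w_def first.best_denominators_iff second.best_denominators_iff by blast+
    have "v < w" using that by (simp add: v_def w_def)
    have "v < Q" unfolding v_def Q_def
      using second.strict_mono_denominator_seq by (simp add: strict_mono_less)
    show ?thesis
    proof (cases "Q \<le> w")
      case True
      have "real Q \<le> (real w)\<^sup>2"
        using True w(1) self_le_power[of "real w" 2] by simp
      also have "\<dots> \<le> K * (real w)\<^sup>2"
        using mult_right_mono[of 1 K "(real w)\<^sup>2"] by (simp add: K_def)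
      finally show ?thesis by (simp add: Q_def w_def)
    next
      case False
      obtain pv where pv: "N' (real v *\<^sub>R x - of_int_vec pv) = \<delta>"
        using second.lattice_dist_attained \<delta>_def by blast
      obtain pw where pw: "N (real w *\<^sub>R x - of_int_vec pw) = first.lattice_dist w"
        using first.lattice_dist_attained by blast
      define e f where "e = real v *\<^sub>R x - of_int_vec pv" and "f = real w *\<^sub>R x - of_int_vec pw"
      \<comment> \<open>As \<open>w\<close> is a record for \<open>N\<close> and
        \<open>v < w\<close>, it beats \<open>v\<close> with any numerator, in particular with
        \<open>pv\<close>, which is optimal for the other norm.\<close>
      have "N f < N e"
        using w(2)[OF v \<open>v < w\<close>] first.lattice_dist_le[of v pv] pw by (simp add: e_def f_def)
      define g where "g = real w *\<^sub>R e - real v *\<^sub>R f"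
      \<comment> \<open>The multiples of \<open>x\<close> cancel.\<close>
      have "g = of_int_vec (\<chi> i. int v * pw $ i - int w * pv $ i)"
        by (simp add: g_def e_def f_def vec_eq_iff algebra_simps)
      moreover have "g \<noteq> 0"
      proof
        assume "g = 0"
        then have "real w *\<^sub>R e = real v *\<^sub>R f" by (simp add: g_def)
        then have "real w * N e = real v * N f"
          by (metis abs_of_nat is_norm_scale[OF first.N])
        moreover have "real v * N f \<le> real w * N f"
          using \<open>v < w\<close> is_norm_nonneg[OF first.N] by (intro mult_right_mono) auto
        moreover have "real w * N f < real w * N e"
          using w(1) \<open>N f < N e\<close> by simp
        ultimately show False by linarith
      qed
      ultimately have "1 \<le> norm g" using norm_of_int_vec_ge_1 by metis
      also have "norm g \<le> real w * norm e + real v * norm f"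
        using norm_triangle_ineq4[of "real w *\<^sub>R e" "real v *\<^sub>R f"] by (simp add: g_def)
      also have "\<dots> \<le> real w * norm e + real w * norm f"
        using \<open>v < w\<close> by (intro add_left_mono mult_right_mono) auto
      also have "\<dots> = real w * (norm e + norm f)" by (simp add: distrib_left)
      also have "norm e + norm f \<le> F * \<delta>"
      proof -
        have "norm f \<le> B * N f" using B by blast
        also have "\<dots> \<le> B * (B * norm e)"
          using B \<open>N f < N e\<close> by (intro mult_left_mono) (auto intro: order_trans[OF less_imp_le])
        also have "\<dots> \<le> B * (B * (A * N' e))"
          using A B by (intro mult_left_mono) auto
        finally have "norm f \<le> B * (B * A) * \<delta>" using pv by (simp add: e_def mult_ac)
        moreover have "norm e \<le> A * \<delta>" using A pv by (auto simp: e_def)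
        ultimately show ?thesis by (simp add: F_def algebra_simps)
      qed
      finally have lower: "1 \<le> real w * (F * \<delta>)" by (simp add: mult_left_mono)
      \<comment> \<open>The largest \<open>T\<close> with \<open>T^2 < Q\<close>, so that the
        denominator \<open>r \<le> T^2\<close> from Dirichlet's theorem stays below
        \<open>Q\<close>.\<close>
      define T where "T = nat \<lfloor>sqrt (real (Q - 1))\<rfloor>"
      have "1 \<le> Q - 1" using v \<open>v < Q\<close> by simp
      then have "1 \<le> sqrt (real (Q - 1))" by simp
      then have T: "0 < T" "real T \<le> sqrt (real (Q - 1))" "sqrt (real (Q - 1)) < real T + 1"
        unfolding T_def by linarith+
      have "(real T)\<^sup>2 \<le> real (Q - 1)"
        using power_mono[OF T(2), of 2] by simp
      then have "T\<^sup>2 \<le> Q - 1" by (simp flip: of_nat_power)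
      have "real (Q - 1) < (real T + 1)\<^sup>2"
        using power_strict_mono[OF T(3), of 2] by simp
      then have "Q - 1 < (T + 1)\<^sup>2"
        by (metis of_nat_1 of_nat_add of_nat_less_iff of_nat_power)
      then have "Q \<le> (T + 1)\<^sup>2" by simp
      also have "\<dots> \<le> (2 * T)\<^sup>2" using T(1) by (intro power_mono) auto
      finally have Q: "real Q \<le> 4 * (real T)\<^sup>2"
        by (metis of_nat_le_iff of_nat_mult of_nat_numeral of_nat_power power_mult_distrib
            four_x_squared)
      obtain r where r: "0 < r" "r \<le> T\<^sup>2" "second.lattice_dist r \<le> C / real T"
        using C(2) T(1) by blast
      \<comment> \<open>Below \<open>v\<close> this holds because \<open>v\<close> is a record; from
        \<open>v\<close> on, \<open>r\<close> lies in the gap before \<open>Q\<close>.\<close>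
      have "\<delta> \<le> second.lattice_dist r"
      proof (cases "r < v")
        case True
        then show ?thesis
          using second.denominator_seq_in[of j] r(1)
          unfolding \<delta>_def v_def second.best_denominators_iff by (simp add: less_imp_le)
      next
        case False
        then show ?thesis
          using second.lattice_dist_gap[of j r] r(2) \<open>T\<^sup>2 \<le> Q - 1\<close> \<open>v < Q\<close>
          by (simp add: \<delta>_def v_def Q_def)
      qed
      with r(3) have "\<delta> \<le> C / real T" by linarith
      have "0 < \<delta>" unfolding \<delta>_def by (rule second.lattice_dist_pos[OF v])
      \<comment> \<open>Multiplying the lower bound by \<open>T\<close> and using
        \<open>\<delta> * T \<le> C\<close> eliminates \<open>\<delta>\<close>.\<close>
      have "real T \<le> real T * (real w * (F * \<delta>))"
        using mult_left_mono[OF lower, of "real T"] by simp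
      also have "\<dots> = real w * F * (\<delta> * real T)" by simp
      also have "\<delta> * real T \<le> C"
        using \<open>\<delta> \<le> C / real T\<close> T(1) by (simp add: field_simps)
      finally have "real T \<le> real w * F * C" using F by (simp add: mult_left_mono)
      then have "(real T)\<^sup>2 \<le> (real w * F * C)\<^sup>2" by (intro power_mono) auto
      with Q have "real Q \<le> (4 * C\<^sup>2 * F\<^sup>2) * (real w)\<^sup>2"
        by (simp add: power_mult_distrib mult_ac)
      also have "\<dots> \<le> K * (real w)\<^sup>2"
        by (intro mult_right_mono) (simp_all add: K_def)
      finally show ?thesis by (simp add: Q_def w_def)
    qed
  qed
  moreover have "1 \<le> K" by (simp add: K_def)
  ultimately show ?thesis by blast
qed

text \<open>Both sequences start at 1, so every denominator for \<open>N'\<close> lies in a gap of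
  those for \<open>N\<close>; the doubling length is 8.\<close>

lemma perez_marco_transfer_norm:
  assumes "perez_marco (denominator_seq N x)"
  shows "perez_marco (denominator_seq N' x)"
proof -
  obtain K where "1 \<le> K" and
    "\<And>j k. denominator_seq N x k \<le> denominator_seq N' x j \<Longrightarrow>
      denominator_seq N' x j < denominator_seq N x (Suc k) \<Longrightarrow>
      real (denominator_seq N' x (Suc j)) \<le> K * (real (denominator_seq N x (Suc k)))\<^sup>2"
    using denominator_seq_gap by blast
  then show ?thesis
    using first.strict_mono_denominator_seq second.strict_mono_denominator_seq
      first.denominator_seq_0 second.denominator_seq_0 second.denominator_seq_doubling assms
    by (intro perez_marco_transfer[of "denominator_seq N x" "denominator_seq N' x" 8 K]) auto
qed

end

theorem corollary1p3:
  fixes l m :: real and N N' :: "real ^ 2 \<Rightarrow> real"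
  assumes "\<not> (l \<in> \<rat> \<and> m \<in> \<rat>)"
    and "is_norm N"
    and "is_norm N'"
  shows "perez_marco (denominator_seq N (vector [l, m])) \<longleftrightarrow>
         perez_marco (denominator_seq N' (vector [l, m]))"
proof -
  define x :: "real ^ 2" where "x = vector [l, m]"
  have irrational: "real q *\<^sub>R x \<noteq> of_int_vec p" if "0 < q" for q p
  proof
    assume "real q *\<^sub>R x = of_int_vec p"
    then have "x $ i = of_int (p $ i) / of_nat q" for i
      using that by (simp add: vec_eq_iff field_simps)
    then have "x $ i \<in> \<rat>" for i by simp
    from this[of 1] this[of 2] show False using assms(1) by (simp add: x_def)
  qed
  interpret first: plane_approximation N x
    using assms irrational by unfold_locales
  interpret second: plane_approximation N' x
    using assms irrational by unfold_locales
  \<comment> \<open>The transfer is one-directional, so the pair of norms is taken in both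
    orders.\<close>
  interpret forward: two_plane_approximations N N' x ..
  interpret backward: two_plane_approximations N' N x ..
  show ?thesis
    using forward.perez_marco_transfer_norm backward.perez_marco_transfer_norm
    unfolding x_def by blast
qed

end
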